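(* Let $\mathbf{C}$ be a topological category and let $F:\mathbf{C}\to\mathbf{T}$ be a monomorphic functor. Then $F$ has a maximal $\emptyset$-modification $F^\circ:\mathbf{C}\to\mathbf{T}$, and it assigns to $\emptyset$ the space $$F^\circ\emptyset=\{a\in F1: Ff_0(a)=Ff_1(a)\}\subset F1,$$ where, for $i\in\{0,1\}$, $f_i:1\to\{i\}\subset 2$ denotes the constant map with value $i$.
   Context: $\mathbf{T}$ is the category whose objects are topological spaces and whose morphisms are all (not necessarily continuous) functions between topological spaces. A topological category is a subcategory $\mathbf{C}$ of $\mathbf{T}$ such that each finite discrete topological space (including $\emptyset$) is an object of $\mathbf{C}$ and each map $f:D\to X$ from a finite discrete space $D$ to an object $X$ of $\mathbf{C}$ is a morphism of $\mathbf{C}$. (Hence monomorphisms of $\mathbf{C}$ are injective functions.) A functor $F:\mathbf{C}\to\mathbf{T}$ is monomorphic if it preserves monomorphisms. A finite ordinal $n$ is identified with the finite discrete space $\{0,\dots,n-1\}$. An $\emptyset$-modification of a monomorphic functor $F:\mathbf{C}\to\mathbf{T}$ is a monomorphic functor $\tilde F:\mathbf{C}\to\mathbf{T}$ such that $\tilde FX=FX$ for each non-empty object $X$ of $\mathbf{C}$, and $\tilde Ff=Ff$ for each morphism $f$ of $\mathbf{C}$ between non-empty objects; so $F$ and $\tilde F$ can differ only on the empty set. An $\emptyset$-modification $G$ of $F$ is maximal if every $\emptyset$-modification $\tilde F$ of $F$ is a subfunctor of $G$, i.e. there is a natural transformation $\tilde F\to G$ with injective components that is the identity on each non-empty object. The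 set $F^\circ\emptyset$ carries the subspace topology from $F1$. *)

theory Defs
  imports "HOL-Analysis.Abstract_Topology" "HOL-Library.FuncSet"
begin

text \<open>
  Spaces are topologies on subsets of a type, which plays the role of the universe. Morphisms are
  arbitrary functions, made extensional so that equality of morphisms with given domain and
  codomain is equality in HOL. An extensional function does not determine its domain or codomain,
  so these are passed explicitly. Hom-sets and functors are only constrained on the objects of the
  category; their values elsewhere are irrelevant.
\<close>

record 'a top_subcat =
  Obj :: "'a topology set"
  Hom :: "'a topology \<Rightarrow> 'a topology \<Rightarrow> ('a \<Rightarrow> 'a) set"

definition top_fun_cat :: "'a top_subcat" where
  "top_fun_cat = \<lparr>Obj = UNIV, Hom = (\<lambda>X Y. topspace X \<rightarrow>\<^sub>E topspace Y)\<rparr>"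

definition id_mor :: "'a topology \<Rightarrow> 'a \<Rightarrow> 'a" where
  "id_mor X = (\<lambda>x\<in>topspace X. x)"

abbreviation comp_mor :: "'a topology \<Rightarrow> ('b \<Rightarrow> 'c) \<Rightarrow> ('a \<Rightarrow> 'b) \<Rightarrow> 'a \<Rightarrow> 'c" where
  "comp_mor X g f \<equiv> compose (topspace X) g f"

definition subcategory :: "'a top_subcat \<Rightarrow> 'a top_subcat \<Rightarrow> bool" where
  "subcategory C D \<longleftrightarrow>
     Obj C \<subseteq> Obj D \<and>
     (\<forall>X\<in>Obj C. \<forall>Y\<in>Obj C. Hom C X Y \<subseteq> Hom D X Y) \<and>
     (\<forall>X\<in>Obj C. id_mor X \<in> Hom C X X) \<and>
     (\<forall>X\<in>Obj C. \<forall>Y\<in>Obj C. \<forall>Z\<in>Obj C. \<forall>f\<in>Hom C X Y. \<forall>g\<in>Hom C Y Z.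
        comp_mor X g f \<in> Hom C X Z)"

definition topological_category :: "'a top_subcat \<Rightarrow> bool" where
  "topological_category C \<longleftrightarrow>
     subcategory C top_fun_cat \<and>
     (\<forall>S. finite S \<longrightarrow> discrete_topology S \<in> Obj C) \<and>
     (\<forall>S. finite S \<longrightarrow> (\<forall>X\<in>Obj C. \<forall>f\<in>S \<rightarrow>\<^sub>E topspace X. f \<in> Hom C (discrete_topology S) X))"

definition monomorphism ::
  "'a top_subcat \<Rightarrow> 'a topology \<Rightarrow> 'a topology \<Rightarrow> ('a \<Rightarrow> 'a) \<Rightarrow> bool" where
  "monomorphism C X Y f \<longleftrightarrow>
     X \<in> Obj C \<and> Y \<in> Obj C \<and> f \<in> Hom C X Y \<and>
     (\<forall>Z\<in>Obj C. \<forall>g\<in>Hom C Z X. \<forall>h\<in>Hom C Z X. comp_mor Z f g = comp_mor Z f h \<longrightarrow> g = h)"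

record ('a, 'b) top_functor =
  FObj :: "'a topology \<Rightarrow> 'b topology"
  FMor :: "'a topology \<Rightarrow> 'a topology \<Rightarrow> ('a \<Rightarrow> 'a) \<Rightarrow> 'b \<Rightarrow> 'b"

definition is_functor ::
  "'a top_subcat \<Rightarrow> 'b top_subcat \<Rightarrow> ('a, 'b) top_functor \<Rightarrow> bool" where
  "is_functor C D F \<longleftrightarrow>
     (\<forall>X\<in>Obj C. FObj F X \<in> Obj D) \<and>
     (\<forall>X\<in>Obj C. \<forall>Y\<in>Obj C. \<forall>f\<in>Hom C X Y. FMor F X Y f \<in> Hom D (FObj F X) (FObj F Y)) \<and>
     (\<forall>X\<in>Obj C. FMor F X X (id_mor X) = id_mor (FObj F X)) \<and>
     (\<forall>X\<in>Obj C. \<forall>Y\<in>Obj C. \<forall>Z\<in>Obj C. \<forall>f\<in>Hom C X Y. \<forall>g\<in>Hom C Y Z.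
        FMor F X Z (comp_mor X g f) = comp_mor (FObj F X) (FMor F Y Z g) (FMor F X Y f))"

definition monomorphic ::
  "'a top_subcat \<Rightarrow> 'b top_subcat \<Rightarrow> ('a, 'b) top_functor \<Rightarrow> bool" where
  "monomorphic C D F \<longleftrightarrow>
     is_functor C D F \<and>
     (\<forall>X Y f. monomorphism C X Y f \<longrightarrow>
        monomorphism D (FObj F X) (FObj F Y) (FMor F X Y f))"

definition natural_transformation ::
  "'a top_subcat \<Rightarrow> 'b top_subcat \<Rightarrow> ('a, 'b) top_functor \<Rightarrow> ('a, 'b) top_functor \<Rightarrow>
   ('a topology \<Rightarrow> 'b \<Rightarrow> 'b) \<Rightarrow> bool" where
  "natural_transformation C D F G \<eta> \<longleftrightarrow>
     (\<forall>X\<in>Obj C. \<eta> X \<in> Hom D (FObj F X) (FObj G X)) \<and>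
     (\<forall>X\<in>Obj C. \<forall>Y\<in>Obj C. \<forall>f\<in>Hom C X Y.
        comp_mor (FObj F X) (\<eta> Y) (FMor F X Y f) = comp_mor (FObj F X) (FMor G X Y f) (\<eta> X))"

definition empty_modification ::
  "'a top_subcat \<Rightarrow> ('a, 'b) top_functor \<Rightarrow> ('a, 'b) top_functor \<Rightarrow> bool" where
  "empty_modification C F G \<longleftrightarrow>
     monomorphic C top_fun_cat G \<and>
     (\<forall>X\<in>Obj C. topspace X \<noteq> {} \<longrightarrow> FObj G X = FObj F X) \<and>
     (\<forall>X\<in>Obj C. \<forall>Y\<in>Obj C. topspace X \<noteq> {} \<longrightarrow> topspace Y \<noteq> {} \<longrightarrow>
        (\<forall>f\<in>Hom C X Y. FMor G X Y f = FMor F X Y f))"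

definition maximal_empty_modification ::
  "'a top_subcat \<Rightarrow> ('a, 'b) top_functor \<Rightarrow> ('a, 'b) top_functor \<Rightarrow> bool" where
  "maximal_empty_modification C F G \<longleftrightarrow>
     empty_modification C F G \<and>
     (\<forall>H. empty_modification C F H \<longrightarrow>
        (\<exists>\<eta>. natural_transformation C top_fun_cat H G \<eta> \<and>
             (\<forall>X\<in>Obj C. inj_on (\<eta> X) (topspace (FObj H X))) \<and>
             (\<forall>X\<in>Obj C. topspace X \<noteq> {} \<longrightarrow> \<eta> X = id_mor (FObj H X))))"

text \<open>
  Since the points of spaces come from an arbitrary type, the identification of a natural number
  with a point is given by an injection \<open>\<iota>\<close>.
\<close>

definition fin_ordinal :: "(nat \<Rightarrow> 'a) \<Rightarrow> nat \<Rightarrow> 'a topology" where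
  "fin_ordinal \<iota> n = discrete_topology (\<iota> ` {..<n})"

definition const_mor :: "(nat \<Rightarrow> 'a) \<Rightarrow> nat \<Rightarrow> 'a \<Rightarrow> 'a" where
  "const_mor \<iota> i = (\<lambda>x\<in>topspace (fin_ordinal \<iota> 1). \<iota> i)"

end

theory Submission
  imports Defs
begin

text \<open>
  Write \<open>1\<close> and \<open>2\<close> for the discrete spaces with one and two points, \<open>f\<^sub>0\<close> and \<open>f\<^sub>1\<close> for the two
  maps \<open>1 \<rightarrow> 2\<close>, and \<open>c\<^sub>y : 1 \<rightarrow> Y\<close> for the map with value \<open>y\<close>, where \<open>y\<close> is a point of \<open>Y\<close>. For
  every modification \<open>H\<close> of \<open>F\<close>, the image under \<open>H\<close> of \<open>\<emptyset> \<rightarrow> 1\<close> maps \<open>H \<emptyset>\<close> injectively into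
  \<open>F 1\<close>, and its values are points that \<open>F f\<^sub>0\<close> and \<open>F f\<^sub>1\<close> do not separate, because both
  composites \<open>\<emptyset> \<rightarrow> 1 \<rightarrow> 2\<close> are the same map (lemmas \<open>inj_on_inclusion\<close>,
  \<open>inclusion_unseparated\<close>). So the set \<open>E\<close> of all unseparated points is an upper bound for every
  possible value on \<open>\<emptyset>\<close>, and the task is to see that \<open>E\<close> itself can serve as the value.

  The map \<open>\<emptyset> \<rightarrow> Y\<close> has to be sent to the restriction of \<open>F c\<^sub>y\<close> to \<open>E\<close>, for some \<open>y\<close> in \<open>Y\<close>.
  This restriction does not depend on \<open>y\<close>: for two points \<open>y\<close> and \<open>z\<close> the map \<open>h : 2 \<rightarrow> Y\<close> with
  values \<open>y\<close> and \<open>z\<close> is a morphism, and \<open>c\<^sub>y = h f\<^sub>0\<close>, \<open>c\<^sub>z = h f\<^sub>1\<close> (lemma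
  \<open>point_on_unseparated\<close>). Functoriality follows from this independence, because \<open>g c\<^sub>y\<close> is again
  the map from \<open>1\<close> with value \<open>g y\<close>. Monomorphisms are preserved since \<open>c\<^sub>y\<close> is a monomorphism of
  the category and the monomorphisms in the category of all functions are exactly the injective
  ones (\<open>monomorphism_top_fun_cat_iff\<close>). The injection of \<open>H \<emptyset>\<close> into \<open>E\<close> described above, with
  identities elsewhere, is the natural transformation required for maximality; naturality for
  \<open>\<emptyset> \<rightarrow> Y\<close> with \<open>Y\<close> nonempty holds because this map factors as \<open>\<emptyset> \<rightarrow> 1 \<rightarrow> Y\<close>.
\<close>

section \<open>Monomorphisms and functors into the category of all functions\<close>

text \<open>
  If \<open>f\<close> identifies two points, the two maps from a one-point space onto these points show that
  \<open>f\<close> is not left cancellable. The test space needs a point of the type of \<open>X\<close>, and one of the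
  two identified points can be taken for it.
\<close>

lemma monomorphism_top_fun_cat_iff:
  "monomorphism top_fun_cat X Y f \<longleftrightarrow> f \<in> topspace X \<rightarrow>\<^sub>E topspace Y \<and> inj_on f (topspace X)"
proof
  assume m: "monomorphism top_fun_cat X Y f"
  have "x = y" if xy: "x \<in> topspace X" "y \<in> topspace X" "f x = f y" for x y
  proof -
    let ?Z = "discrete_topology {x}"
    let ?c = "\<lambda>z. \<lambda>u\<in>{x}. z"
    have "comp_mor ?Z f (?c x) = comp_mor ?Z f (?c y)"
      using xy by (auto simp: compose_def)
    moreover have "?c x \<in> Hom top_fun_cat ?Z X" "?c y \<in> Hom top_fun_cat ?Z X"
      using xy by (auto simp: top_fun_cat_def)
    moreover have "?Z \<in> Obj top_fun_cat" by (simp add: top_fun_cat_def)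
    ultimately have "?c x = ?c y"
      using m unfolding monomorphism_def by blast
    then show "x = y" by (metis restrict_apply singletonI)
  qed
  then show "f \<in> topspace X \<rightarrow>\<^sub>E topspace Y \<and> inj_on f (topspace X)"
    using m by (auto simp: inj_on_def monomorphism_def top_fun_cat_def)
next
  assume f: "f \<in> topspace X \<rightarrow>\<^sub>E topspace Y \<and> inj_on f (topspace X)"
  have "g = h" if gh: "g \<in> topspace Z \<rightarrow>\<^sub>E topspace X" "h \<in> topspace Z \<rightarrow>\<^sub>E topspace X"
    "comp_mor Z f g = comp_mor Z f h" for Z g h
  proof (rule PiE_ext[OF gh(1,2)])
    fix z assume z: "z \<in> topspace Z"
    then have "f (g z) = f (h z)" using fun_cong[OF gh(3), of z] by (simp add: compose_def)
    then show "g z = h z"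
      using f gh(1,2) z by (meson PiE_mem inj_onD)
  qed
  then show "monomorphism top_fun_cat X Y f"
    using f by (auto simp: monomorphism_def top_fun_cat_def)
qed

lemma monomorphism_subcategory:
  assumes "subcategory C D" "monomorphism D X Y f"
    and "X \<in> Obj C" "Y \<in> Obj C" "f \<in> Hom C X Y"
  shows "monomorphism C X Y f"
  using assms unfolding monomorphism_def subcategory_def by (meson subsetD)

lemma functor_FMor_PiE:
  assumes "is_functor C top_fun_cat F" "X \<in> Obj C" "Y \<in> Obj C" "f \<in> Hom C X Y"
  shows "FMor F X Y f \<in> topspace (FObj F X) \<rightarrow>\<^sub>E topspace (FObj F Y)"
  using assms by (auto simp: is_functor_def top_fun_cat_def)

lemma functor_comp_apply:
  assumes "is_functor C D F" "X \<in> Obj C" "Y \<in> Obj C" "Z \<in> Obj C"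
    "f \<in> Hom C X Y" "g \<in> Hom C Y Z" "a \<in> topspace (FObj F X)"
  shows "FMor F X Z (comp_mor X g f) a = FMor F Y Z g (FMor F X Y f a)"
  using assms by (simp add: is_functor_def compose_def)

section \<open>Points of spaces in a topological category\<close>

locale pointed_topological_category =
  fixes C :: "'a top_subcat" and \<iota> :: "nat \<Rightarrow> 'a"
  assumes inj_\<iota>: "inj \<iota>" and topcat: "topological_category C"
begin

\<comment> \<open>The simplifier must not turn the index of \<open>fin_ordinal \<iota> 1\<close> into \<open>Suc 0\<close>.\<close>
declare One_nat_def [simp del]

abbreviation "One \<equiv> fin_ordinal \<iota> 1"
abbreviation "Two \<equiv> fin_ordinal \<iota> 2"

definition point :: "'a \<Rightarrow> 'a \<Rightarrow> 'a" where
  "point y = (\<lambda>x\<in>topspace One. y)"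

lemma subcat: "subcategory C top_fun_cat"
  using topcat by (simp add: topological_category_def)

lemma Hom_PiE:
  assumes "X \<in> Obj C" "Y \<in> Obj C" "f \<in> Hom C X Y"
  shows "f \<in> topspace X \<rightarrow>\<^sub>E topspace Y"
  using assms subcat by (auto simp: subcategory_def top_fun_cat_def)

lemma discrete_Obj: "finite S \<Longrightarrow> discrete_topology S \<in> Obj C"
  using topcat by (simp add: topological_category_def)

lemma discrete_Hom:
  "finite S \<Longrightarrow> X \<in> Obj C \<Longrightarrow> f \<in> S \<rightarrow>\<^sub>E topspace X \<Longrightarrow> f \<in> Hom C (discrete_topology S) X"
  using topcat by (simp add: topological_category_def)

lemma trivial_Obj [simp]: "trivial_topology \<in> Obj C"
  by (simp add: discrete_Obj)

lemma One_Obj [simp]: "One \<in> Obj C" and Two_Obj [simp]: "Two \<in> Obj C"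
  by (simp_all add: fin_ordinal_def discrete_Obj)

lemma topspace_One: "topspace One = {\<iota> 0}"
  by (auto simp: fin_ordinal_def)

lemma topspace_Two: "topspace Two = {\<iota> 0, \<iota> 1}"
  by (auto simp: fin_ordinal_def numeral_2_eq_2 lessThan_Suc One_nat_def)

lemma One_nontrivial [simp]: "One \<noteq> trivial_topology"
  by (metis topspace_One empty_not_insert null_topspace_iff_trivial)

lemma const_mor_eq_point: "const_mor \<iota> i = point (\<iota> i)"
  by (simp add: const_mor_def point_def)

lemma point_Hom:
  assumes "Y \<in> Obj C" "y \<in> topspace Y"
  shows "point y \<in> Hom C One Y"
  unfolding fin_ordinal_def using assms
  by (intro discrete_Hom) (auto simp: point_def fin_ordinal_def)

lemma comp_point: "comp_mor One g (point y) = point (g y)"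
  by (auto simp: compose_def point_def)

lemma monomorphism_point:
  assumes "Y \<in> Obj C" "y \<in> topspace Y"
  shows "monomorphism C One Y (point y)"
proof (rule monomorphism_subcategory[OF subcat])
  show "monomorphism top_fun_cat One Y (point y)"
    using Hom_PiE[OF _ _ point_Hom] assms
    by (simp add: monomorphism_top_fun_cat_iff topspace_One)
qed (use assms point_Hom in auto)

lemma Hom_into_trivial:
  assumes "X \<in> Obj C" "f \<in> Hom C X trivial_topology"
  shows "X = trivial_topology"
proof -
  have "f \<in> topspace X \<rightarrow>\<^sub>E {}" using Hom_PiE[OF assms(1) _ assms(2)] by simp
  then have "topspace X = {}" by (metis PiE_mem all_not_in_conv)
  then show ?thesis by simp
qed

lemma Hom_from_trivial:
  "Y \<in> Obj C \<Longrightarrow> f \<in> Hom C trivial_topology Y \<longleftrightarrow> f = (\<lambda>_. undefined)"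
  using Hom_PiE[of trivial_topology Y f] discrete_Hom[of "{}" Y f] by auto

lemma monomorphism_from_trivial:
  assumes "Y \<in> Obj C"
  shows "monomorphism C trivial_topology Y (\<lambda>_. undefined)"
  by (rule monomorphism_subcategory[OF subcat])
    (use assms Hom_from_trivial in \<open>auto simp: monomorphism_top_fun_cat_iff\<close>)

lemma id_mor_trivial: "id_mor trivial_topology = (\<lambda>_. undefined)"
  by (auto simp: id_mor_def)

lemma comp_mor_trivial: "compose {} g f = (\<lambda>_. undefined)"
  by (auto simp: compose_def)

end

section \<open>The maximal modification\<close>

locale monomorphic_functor = pointed_topological_category C \<iota>
  for C :: "'a top_subcat" and \<iota> :: "nat \<Rightarrow> 'a" +
  fixes F :: "('a, 'b) top_functor"
  assumes mono_F: "monomorphic C top_fun_cat F"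
begin

definition unseparated :: "'b set" where
  "unseparated = {a \<in> topspace (FObj F One).
     FMor F One Two (const_mor \<iota> 0) a = FMor F One Two (const_mor \<iota> 1) a}"

definition empty_value :: "'b topology" where
  "empty_value = subtopology (FObj F One) unseparated"

text \<open>
  The only morphism from the empty space to a given space is the extensional function with
  constant value \<open>undefined\<close>, so the value of \<open>FMor\<close> there is determined by the codomain. The point chosen by \<open>SOME\<close> is immaterial, by
  \<open>point_on_unseparated\<close> below.
\<close>

definition maximal_modification :: "('a, 'b) top_functor" where
  "maximal_modification =
    \<lparr>FObj = (\<lambda>X. if X = trivial_topology then empty_value else FObj F X),
     FMor = (\<lambda>X Y f.
       if X \<noteq> trivial_topology then FMor F X Y f
       else if Y = trivial_topology then id_mor empty_value
       else restrict (FMor F One Y (point (SOME y. y \<in> topspace Y))) unseparated)\<rparr>"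

lemma functor_F: "is_functor C top_fun_cat F"
  using mono_F by (simp add: monomorphic_def)

lemma topspace_empty_value: "topspace empty_value = unseparated"
  by (auto simp: empty_value_def unseparated_def)

lemma FObj_trivial: "FObj maximal_modification trivial_topology = empty_value"
  and FObj_nontrivial:
    "X \<noteq> trivial_topology \<Longrightarrow> FObj maximal_modification X = FObj F X"
  and FMor_nontrivial:
    "X \<noteq> trivial_topology \<Longrightarrow> FMor maximal_modification X Y f = FMor F X Y f"
  and FMor_trivial:
    "FMor maximal_modification trivial_topology trivial_topology f = id_mor empty_value"
  by (simp_all add: maximal_modification_def)

text \<open>
  Any two points of \<open>Y\<close> are the values of a single morphism \<open>2 \<rightarrow> Y\<close>, so that equality of the
  values in \<open>F 2\<close> carries over to \<open>F Y\<close>.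
\<close>

lemma point_on_unseparated:
  assumes Y: "Y \<in> Obj C" "y \<in> topspace Y" "z \<in> topspace Y" and a: "a \<in> unseparated"
  shows "FMor F One Y (point y) a = FMor F One Y (point z) a"
proof -
  define h where "h = (\<lambda>u\<in>topspace Two. if u = \<iota> 0 then y else z)"
  have h: "h \<in> Hom C Two Y"
    unfolding fin_ordinal_def using Y
    by (intro discrete_Hom) (auto simp: h_def fin_ordinal_def)
  have "\<iota> 1 \<noteq> \<iota> 0" using inj_\<iota> by (simp add: inj_eq)
  then have h01: "h (\<iota> 0) = y" "h (\<iota> 1) = z" by (auto simp: h_def topspace_Two)
  have aF: "a \<in> topspace (FObj F One)" using a by (simp add: unseparated_def)
  have *: "FMor F One Y (point (h i)) a = FMor F Two Y h (FMor F One Two (point i) a)"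
    if "i \<in> topspace Two" for i
    using functor_comp_apply[OF functor_F _ _ _ point_Hom h aF] that Y(1)
    by (simp add: comp_point)
  show ?thesis
    using *[of "\<iota> 0"] *[of "\<iota> 1"] a
    by (simp add: h01 topspace_Two unseparated_def const_mor_eq_point)
qed

lemma FMor_from_trivial:
  assumes "Y \<in> Obj C" "y \<in> topspace Y"
  shows "FMor maximal_modification trivial_topology Y f =
    restrict (FMor F One Y (point y)) unseparated"
proof -
  have "Y \<noteq> trivial_topology" using assms by auto
  moreover have "(SOME y. y \<in> topspace Y) \<in> topspace Y"
    using assms(2) by (rule someI)
  ultimately show ?thesis
    using point_on_unseparated[OF assms(1) _ assms(2)]
    by (auto simp: maximal_modification_def intro!: restrict_ext)
qed

lemma FMor_maximal_modification_PiE: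
  assumes "X \<in> Obj C" "Y \<in> Obj C" "f \<in> Hom C X Y"
  shows "FMor maximal_modification X Y f \<in>
    topspace (FObj maximal_modification X) \<rightarrow>\<^sub>E topspace (FObj maximal_modification Y)"
proof (cases "X = trivial_topology")
  case False
  then have "Y \<noteq> trivial_topology" using assms Hom_into_trivial by blast
  then show ?thesis
    using False functor_FMor_PiE[OF functor_F assms]
    by (simp add: FObj_nontrivial FMor_nontrivial)
next
  case X: True
  show ?thesis
  proof (cases "Y = trivial_topology")
    case True
    then show ?thesis using X by (auto simp: FObj_trivial FMor_trivial id_mor_def)
  next
    case False
    then obtain y where y: "y \<in> topspace Y" by fastforce
    have "FMor F One Y (point y) \<in> topspace (FObj F One) \<rightarrow>\<^sub>E topspace (FObj F Y)"
      using functor_FMor_PiE[OF functor_F _ _ point_Hom] assms(2) y by simp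
    then show ?thesis
      using X False FMor_from_trivial[OF assms(2) y]
      by (auto simp: FObj_trivial FObj_nontrivial topspace_empty_value unseparated_def)
  qed
qed

text \<open>
  The case that carries content is \<open>\<emptyset> \<rightarrow> Y \<rightarrow> Z\<close> with \<open>Y\<close> nonempty: if the point \<open>y\<close> of \<open>Y\<close>
  represents \<open>\<emptyset> \<rightarrow> Y\<close>, then its image \<open>g y\<close> may be used to represent \<open>\<emptyset> \<rightarrow> Z\<close>.
\<close>

lemma FMor_maximal_modification_comp:
  assumes X: "X \<in> Obj C" and Y: "Y \<in> Obj C" and Z: "Z \<in> Obj C"
    and f: "f \<in> Hom C X Y" and g: "g \<in> Hom C Y Z"
  shows "FMor maximal_modification X Z (comp_mor X g f) =
    comp_mor (FObj maximal_modification X)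
      (FMor maximal_modification Y Z g) (FMor maximal_modification X Y f)"
proof (cases "X = trivial_topology")
  case False
  then have "Y \<noteq> trivial_topology" using X f Hom_into_trivial by blast
  with False show ?thesis
    using functor_F X Y Z f g
    by (simp add: FObj_nontrivial FMor_nontrivial is_functor_def)
next
  case Xe: True
  show ?thesis
  proof (cases "Y = trivial_topology")
    case True
    have g_eq: "g = (\<lambda>_. undefined)" using Hom_from_trivial[OF Z] g True by simp
    have "FMor maximal_modification X Z (\<lambda>_. undefined) \<in>
        topspace (FObj maximal_modification X) \<rightarrow>\<^sub>E topspace (FObj maximal_modification Z)"
      using FMor_maximal_modification_PiE[OF X Z] Hom_from_trivial[OF Z] Xe by simp
    then show ?thesis
      using Xe True unfolding g_eq
      by (auto simp: comp_mor_trivial FObj_trivial FMor_trivial id_mor_def compose_def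
          topspace_empty_value PiE_def extensional_def fun_eq_iff)
  next
    case False
    then obtain y where y: "y \<in> topspace Y" by fastforce
    then have gy: "g y \<in> topspace Z" using Hom_PiE[OF Y Z g] by auto
    have "FMor F One Z (point (g y)) a = FMor F Y Z g (FMor F One Y (point y) a)"
      if "a \<in> unseparated" for a
      using functor_comp_apply[OF functor_F One_Obj Y Z point_Hom[OF Y y] g, of a] that
      by (simp add: comp_point unseparated_def)
    then show ?thesis
      using Xe False
      by (auto simp: FMor_from_trivial[OF Y y] FMor_from_trivial[OF Z gy] FMor_nontrivial
          FObj_trivial topspace_empty_value compose_def fun_eq_iff)
  qed
qed

lemma functor_maximal_modification: "is_functor C top_fun_cat maximal_modification"
  unfolding is_functor_def
proof (intro conjI ballI)
  fix X assume "X \<in> Obj C"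
  then show "FMor maximal_modification X X (id_mor X) = id_mor (FObj maximal_modification X)"
    using functor_F
    by (cases "X = trivial_topology")
      (auto simp: FObj_trivial FMor_trivial FObj_nontrivial FMor_nontrivial is_functor_def)
qed (use FMor_maximal_modification_PiE FMor_maximal_modification_comp
     in \<open>auto simp: top_fun_cat_def\<close>)

lemma FMor_maximal_modification_monomorphism:
  assumes m: "monomorphism C X Y f"
  shows "monomorphism top_fun_cat (FObj maximal_modification X) (FObj maximal_modification Y)
    (FMor maximal_modification X Y f)"
proof -
  have XY: "X \<in> Obj C" "Y \<in> Obj C" "f \<in> Hom C X Y"
    using m by (simp_all add: monomorphism_def)
  have "inj_on (FMor maximal_modification X Y f) (topspace (FObj maximal_modification X))"
  proof (cases "X = trivial_topology")
    case False
    have "monomorphism top_fun_cat (FObj F X) (FObj F Y) (FMor F X Y f)"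
      using mono_F m by (simp add: monomorphic_def)
    with False show ?thesis
      by (simp add: FObj_nontrivial FMor_nontrivial monomorphism_top_fun_cat_iff)
  next
    case X: True
    show ?thesis
    proof (cases "Y = trivial_topology")
      case True
      with X show ?thesis by (simp add: FObj_trivial FMor_trivial id_mor_def)
    next
      case False
      then obtain y where y: "y \<in> topspace Y" by fastforce
      have "monomorphism top_fun_cat (FObj F One) (FObj F Y) (FMor F One Y (point y))"
        using mono_F monomorphism_point[OF XY(2) y] by (simp add: monomorphic_def)
      then have "inj_on (FMor F One Y (point y)) unseparated"
        by (rule inj_on_subset[OF conjunct2[OF monomorphism_top_fun_cat_iff[THEN iffD1]]])
          (auto simp: unseparated_def)
      with X show ?thesis
        by (simp add: FMor_from_trivial[OF XY(2) y] FObj_trivial topspace_empty_value)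
    qed
  qed
  then show ?thesis
    using FMor_maximal_modification_PiE[OF XY] by (simp add: monomorphism_top_fun_cat_iff)
qed

lemma empty_modification_maximal_modification: "empty_modification C F maximal_modification"
  using functor_maximal_modification FMor_maximal_modification_monomorphism
  by (simp add: empty_modification_def monomorphic_def FObj_nontrivial FMor_nontrivial)

section \<open>Maximality\<close>

context
  fixes H :: "('a, 'b) top_functor"
  assumes modification: "empty_modification C F H"
begin

abbreviation "inclusion \<equiv> FMor H trivial_topology One (\<lambda>_. undefined)"

lemma mono_H: "monomorphic C top_fun_cat H" and functor_H: "is_functor C top_fun_cat H"
  using modification by (simp_all add: empty_modification_def monomorphic_def)

lemma H_Obj:
  "X \<in> Obj C \<Longrightarrow> X \<noteq> trivial_topology \<Longrightarrow> FObj H X = FObj F X"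
  using modification by (simp add: empty_modification_def)

lemma H_Mor:
  assumes "X \<in> Obj C" "Y \<in> Obj C" "f \<in> Hom C X Y" "X \<noteq> trivial_topology"
  shows "FMor H X Y f = FMor F X Y f"
proof -
  have "Y \<noteq> trivial_topology" using assms Hom_into_trivial by blast
  with assms show ?thesis
    using modification by (simp add: empty_modification_def)
qed

lemma H_factor:
  assumes Y: "Y \<in> Obj C" "y \<in> topspace Y" and a: "a \<in> topspace (FObj H trivial_topology)"
  shows "FMor H trivial_topology Y (\<lambda>_. undefined) a = FMor F One Y (point y) (inclusion a)"
  using functor_comp_apply[OF functor_H _ _ _ _ point_Hom[OF Y] a, of "\<lambda>_. undefined"] Y
    Hom_from_trivial[OF One_Obj] H_Mor[OF _ _ point_Hom[OF Y]]
  by (simp add: comp_mor_trivial)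

text \<open>
  By \<open>H_factor\<close>, both sides of the equation that defines \<open>unseparated\<close> are the value at \<open>a\<close> of
  the image under \<open>H\<close> of the unique map \<open>\<emptyset> \<rightarrow> 2\<close>.
\<close>

lemma inclusion_unseparated:
  assumes a: "a \<in> topspace (FObj H trivial_topology)"
  shows "inclusion a \<in> unseparated"
proof -
  have "inclusion \<in> topspace (FObj H trivial_topology) \<rightarrow>\<^sub>E topspace (FObj H One)"
    using functor_FMor_PiE[OF functor_H] Hom_from_trivial by simp
  then have "inclusion a \<in> topspace (FObj F One)"
    using a H_Obj[of One] by auto
  moreover have "FMor F One Two (point (\<iota> 0)) (inclusion a) =
      FMor F One Two (point (\<iota> 1)) (inclusion a)"
    using H_factor[OF Two_Obj _ a] topspace_Two by (metis insertCI)
  ultimately show ?thesis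
    by (simp add: unseparated_def const_mor_eq_point)
qed

text \<open>
  The map \<open>\<emptyset> \<rightarrow> 1\<close> is a monomorphism, since only \<open>\<emptyset>\<close> has a map to \<open>\<emptyset>\<close>, and only one.
\<close>

lemma inj_on_inclusion: "inj_on inclusion (topspace (FObj H trivial_topology))"
  using mono_H monomorphism_from_trivial[OF One_Obj]
  by (auto simp: monomorphic_def monomorphism_top_fun_cat_iff)

definition comparison :: "'a topology \<Rightarrow> 'b \<Rightarrow> 'b" where
  "comparison X = (if X = trivial_topology then inclusion else id_mor (FObj H X))"

lemma comparison_PiE:
  assumes "X \<in> Obj C"
  shows "comparison X \<in> topspace (FObj H X) \<rightarrow>\<^sub>E topspace (FObj maximal_modification X)"
proof (cases "X = trivial_topology")
  case True
  have "inclusion \<in> topspace (FObj H trivial_topology) \<rightarrow>\<^sub>E topspace (FObj H One)"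
    using functor_FMor_PiE[OF functor_H] Hom_from_trivial by simp
  with True show ?thesis
    using inclusion_unseparated
    by (auto simp: comparison_def FObj_trivial topspace_empty_value)
next
  case False
  with assms show ?thesis
    by (auto simp: comparison_def H_Obj FObj_nontrivial id_mor_def)
qed

lemma comparison_natural:
  assumes XY: "X \<in> Obj C" "Y \<in> Obj C" "f \<in> Hom C X Y" and a: "a \<in> topspace (FObj H X)"
  shows "comparison Y (FMor H X Y f a) = FMor maximal_modification X Y f (comparison X a)"
proof (cases "Y = trivial_topology")
  case True
  then have X: "X = trivial_topology" using XY Hom_into_trivial by blast
  then have "f = id_mor trivial_topology"
    using Hom_from_trivial[OF XY(2)] XY(3) X by (simp add: id_mor_trivial)
  then have "FMor H X Y f = id_mor (FObj H trivial_topology)"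
    using functor_H X True by (simp add: is_functor_def)
  then show ?thesis
    using X True a inclusion_unseparated
    by (simp add: comparison_def FMor_trivial id_mor_def topspace_empty_value)
next
  case Y: False
  have "FMor H X Y f a \<in> topspace (FObj H Y)"
    using functor_FMor_PiE[OF functor_H XY] a by auto
  then have *: "comparison Y (FMor H X Y f a) = FMor H X Y f a"
    using Y by (simp add: comparison_def id_mor_def)
  show ?thesis
  proof (cases "X = trivial_topology")
    case True
    obtain y where y: "y \<in> topspace Y" using Y by fastforce
    have "f = (\<lambda>_. undefined)" using Hom_from_trivial[OF XY(2)] XY(3) True by simp
    then show ?thesis
      unfolding * using True a H_factor[OF XY(2) y] inclusion_unseparated
      by (simp add: comparison_def FMor_from_trivial[OF XY(2) y])
  next
    case False
    then show ?thesis
      unfolding * using a H_Mor[OF XY] by (simp add: comparison_def FMor_nontrivial id_mor_def)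
  qed
qed

lemma comparison_natural_transformation:
  "natural_transformation C top_fun_cat H maximal_modification comparison"
  unfolding natural_transformation_def
  using comparison_PiE comparison_natural
  by (auto simp: top_fun_cat_def compose_def intro!: restrict_ext)

lemma inj_on_comparison: "inj_on (comparison X) (topspace (FObj H X))"
  using inj_on_inclusion by (simp add: comparison_def id_mor_def)

end

lemma maximal: "maximal_empty_modification C F maximal_modification"
  unfolding maximal_empty_modification_def
proof (intro conjI allI impI)
  fix H assume H: "empty_modification C F H"
  show "\<exists>\<eta>. natural_transformation C top_fun_cat H maximal_modification \<eta> \<and>
      (\<forall>X\<in>Obj C. inj_on (\<eta> X) (topspace (FObj H X))) \<and>
      (\<forall>X\<in>Obj C. topspace X \<noteq> {} \<longrightarrow> \<eta> X = id_mor (FObj H X))"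
    using comparison_natural_transformation[OF H] inj_on_comparison[OF H]
    by (intro exI[of _ "comparison H"]) (auto simp: comparison_def[OF H])
qed (rule empty_modification_maximal_modification)

end

theorem theorem1:
  fixes C :: "'a top_subcat" and F :: "('a, 'b) top_functor" and \<iota> :: "nat \<Rightarrow> 'a"
  assumes "inj \<iota>"
    and "topological_category C"
    and "monomorphic C top_fun_cat F"
  shows "\<exists>G. maximal_empty_modification C F G \<and>
    FObj G (discrete_topology {}) =
      subtopology (FObj F (fin_ordinal \<iota> 1))
        {a \<in> topspace (FObj F (fin_ordinal \<iota> 1)).
           FMor F (fin_ordinal \<iota> 1) (fin_ordinal \<iota> 2) (const_mor \<iota> 0) a =
           FMor F (fin_ordinal \<iota> 1) (fin_ordinal \<iota> 2) (const_mor \<iota> 1) a}"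
proof -
  interpret monomorphic_functor C \<iota> F
    using assms by unfold_locales
  show ?thesis
    using maximal FObj_trivial
    unfolding empty_value_def unseparated_def by blast
qed

end
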